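(* Let $R$ be a commutative ring. The following statements are equivalent: (1) $R$ is endoartinian; (2) $R$ satisfies the strongly DCCR* condition; (3) $R$ satisfies the strongly ACCR* condition and $\dim(R)=0$.
   Context: Rings are associative with unity. A right $R$-module $M$ is endoartinian if for every sequence $f_1,f_2,\dots\in \operatorname{End}_R(M)$ with $\operatorname{Im}(f_1)\supseteq \operatorname{Im}(f_2)\supseteq\cdots$ there is $n$ such that $\operatorname{Im}(f_k)=\operatorname{Im}(f_n)$ for all $k\ge n$. A commutative ring $R$ is endoartinian if $R$ is endoartinian as a module over itself. A commutative ring $R$ satisfies the strongly DCCR* condition if for every ideal $I\subseteq R$ and every sequence $\{a_i\}_{i\in\mathbb N}\subseteq R$, the descending chain $Ia_1\supseteq Ia_1a_2\supseteq Ia_1a_2a_3\supseteq\cdots$ stabilizes. A commutative ring $R$ satisfies the strongly ACCR* condition if for every ideal $I\subseteq R$ and every sequence $\{a_i\}_{i\in\mathbb N}\subseteq R$, the ascending chain $(I:_R a_1)\subseteq (I:_R a_1a_2)\subseteq (I:_R a_1a_2a_3)\subseteq\cdots$ stabilizes, where $(I:_R x)=\{r\in R: xr\in I\}$. $\dim(R)$ denotes the Krull dimension of $R$. *)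

theory Defs
  imports "HOL-Algebra.Algebra" "HOL-Library.Extended_Nat"
begin

text \<open>
  As in HOL-Algebra, \<open>r \<odot>\<^bsub>M\<^esub> x\<close> denotes the action of \<open>r\<close> on \<open>x\<close>; over a commutative ring,
  left and right modules coincide. Endomorphisms are total HOL functions, of which
  only the values on \<open>carrier M\<close> matter; so the image is \<open>f ` carrier M\<close>.
\<close>

definition module_End :: "('r, 'k) ring_scheme \<Rightarrow> ('r, 'm, 'l) module_scheme \<Rightarrow> ('m \<Rightarrow> 'm) set"
  where "module_End R M =
    {f \<in> hom (add_monoid M) (add_monoid M).
      \<forall>r\<in>carrier R. \<forall>x\<in>carrier M. f (r \<odot>\<^bsub>M\<^esub> x) = r \<odot>\<^bsub>M\<^esub> f x}"

definition endoartinian_module :: "('r, 'k) ring_scheme \<Rightarrow> ('r, 'm, 'l) module_scheme \<Rightarrow> bool"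
  where "endoartinian_module R M \<longleftrightarrow>
    (\<forall>f :: nat \<Rightarrow> 'm \<Rightarrow> 'm.
      (\<forall>i. f i \<in> module_End R M) \<longrightarrow>
      (\<forall>i. f (Suc i) ` carrier M \<subseteq> f i ` carrier M) \<longrightarrow>
      (\<exists>n. \<forall>k\<ge>n. f k ` carrier M = f n ` carrier M))"

definition self_module :: "('a, 'k) ring_scheme \<Rightarrow> ('a, 'a) module"
  where "self_module R =
    \<lparr>carrier = carrier R, monoid.mult = monoid.mult R, one = \<one>\<^bsub>R\<^esub>,
      ring.zero = \<zero>\<^bsub>R\<^esub>, ring.add = add R, smult = monoid.mult R\<rparr>"

lemma module_self_module:
  assumes "cring R"
  shows "module R (self_module R)"
proof -
  interpret cring R by fact
  have "abelian_group (self_module R)"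
    by (rule abelian_groupI) (auto simp: self_module_def a_ac intro: l_neg)
  then show ?thesis
    by (intro moduleI assms) (auto simp: self_module_def l_distr r_distr m_assoc)
qed

definition endoartinian_ring :: "('a, 'k) ring_scheme \<Rightarrow> bool"
  where "endoartinian_ring R \<longleftrightarrow> endoartinian_module R (self_module R)"

text \<open>
  Sequences are indexed from \<open>0\<close>, so the \<open>n\<close>-th product is \<open>a 0 \<otimes> \<dots> \<otimes> a n\<close>.
  The coset \<open>I #>\<^bsub>R\<^esub> x\<close> is multiplicative: it is \<open>{i \<otimes>\<^bsub>R\<^esub> x | i. i \<in> I}\<close>.
\<close>

definition strongly_DCCR_star :: "('a, 'k) ring_scheme \<Rightarrow> bool"
  where "strongly_DCCR_star R \<longleftrightarrow>
    (\<forall>I (a :: nat \<Rightarrow> 'a).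
      ideal I R \<longrightarrow> (\<forall>i. a i \<in> carrier R) \<longrightarrow>
      (\<exists>n. \<forall>k\<ge>n. I #>\<^bsub>R\<^esub> finprod R a {..k} = I #>\<^bsub>R\<^esub> finprod R a {..n}))"

definition ideal_colon :: "('a, 'k) ring_scheme \<Rightarrow> 'a set \<Rightarrow> 'a \<Rightarrow> 'a set"
  where "ideal_colon R I x = {r \<in> carrier R. x \<otimes>\<^bsub>R\<^esub> r \<in> I}"

definition strongly_ACCR_star :: "('a, 'k) ring_scheme \<Rightarrow> bool"
  where "strongly_ACCR_star R \<longleftrightarrow>
    (\<forall>I (a :: nat \<Rightarrow> 'a).
      ideal I R \<longrightarrow> (\<forall>i. a i \<in> carrier R) \<longrightarrow>
      (\<exists>n. \<forall>k\<ge>n. ideal_colon R I (finprod R a {..k}) = ideal_colon R I (finprod R a {..n})))"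

text \<open>
  The supremum of the lengths \<open>n\<close> of chains \<open>P 0 \<subset> \<dots> \<subset> P n\<close> of prime ideals. The supremum
  is taken in \<^typ>\<open>enat\<close>, so the zero ring, which has no prime ideals, gets dimension \<open>0\<close>.
\<close>

definition krull_dim :: "('a, 'k) ring_scheme \<Rightarrow> enat"
  where "krull_dim R =
    Sup {enat n | n. \<exists>P :: nat \<Rightarrow> 'a set.
      (\<forall>i\<le>n. primeideal (P i) R) \<and> (\<forall>i<n. P i \<subset> P (Suc i))}"

end

theory Submission
  imports Defs
begin

text \<open>
  Endomorphisms of \<open>R\<close> are multiplications by ring elements, and every descending chain of principal
  ideals arises from partial products, so (1) and (2) both say that partial products
  \<open>b\<^sub>n = a\<^sub>0 \<dots> a\<^sub>n\<close> eventually generate the same principal ideal. If \<open>b\<^sub>k\<close> divides \<open>b\<^sub>n\<close>, then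
  \<open>(I : b\<^sub>k) \<subseteq> (I : b\<^sub>n)\<close>, which gives the ascending condition; the constant sequence \<open>a\<close> gives
  \<open>a\<^sup>m = a\<^sup>m\<^sup>+\<^sup>1 r\<close>, whence primes are maximal. Conversely, dimension \<open>0\<close> implies
  \<open>a\<^sup>m (1 - a r) = 0\<close> for some \<open>m\<close> and \<open>r\<close>. If the annihilators of the \<open>b\<^sub>k\<close> are constant from \<open>n\<close> on
  and \<open>a = a\<^sub>k\<^sub>+\<^sub>1\<close>, then the factor \<open>a\<close> can be cancelled \<open>m\<close> times from \<open>b\<^sub>k a\<^sup>m (1 - a r) = 0\<close>,
  so \<open>b\<^sub>k = b\<^sub>k a r = b\<^sub>k\<^sub>+\<^sub>1 r\<close>.
\<close>

context cring
begin

section \<open>Prime ideals and dimension zero\<close>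

text \<open>Zorn's lemma yields an ideal maximal among those containing \<open>I\<close> and missing
  the multiplicative set \<open>S\<close>; maximality makes it prime.\<close>

lemma exists_primeideal_disjoint:
  assumes I: "ideal I R"
    and S: "S \<subseteq> carrier R" "\<one> \<in> S" "\<And>x y. x \<in> S \<Longrightarrow> y \<in> S \<Longrightarrow> x \<otimes> y \<in> S"
    and disj: "I \<inter> S = {}"
  obtains P where "primeideal P R" "I \<subseteq> P" "P \<inter> S = {}"
proof -
  let ?A = "{J. ideal J R \<and> I \<subseteq> J \<and> J \<inter> S = {}}"
  have "\<exists>P\<in>?A. \<forall>J\<in>?A. P \<subseteq> J \<longrightarrow> J = P"
  proof (rule subset_Zorn_nonempty)
    show "?A \<noteq> {}" using I disj by blast
  next
    fix C assume C: "C \<noteq> {}" "subset.chain ?A C"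
    have "subset.chain {J. ideal J R} C"
      using C(2) unfolding pred_on.chain_def by blast
    then have "ideal (\<Union>C) R"
      using chain_Union_is_ideal[of C] C(1) by simp
    moreover have "I \<subseteq> \<Union>C" "\<Union>C \<inter> S = {}"
      using C unfolding pred_on.chain_def by blast+
    ultimately show "\<Union>C \<in> ?A" by blast
  qed
  then obtain P where P_mem: "P \<in> ?A" and P_max: "\<forall>J\<in>?A. P \<subseteq> J \<longrightarrow> J = P"
    by (rule bexE)
  from P_mem have P: "ideal P R" "I \<subseteq> P" "P \<inter> S = {}"
    by simp_all
  interpret P: ideal P R by fact
  \<comment> \<open>For \<open>x\<close> outside \<open>P\<close>, the ideal P + Rx is strictly
    larger than \<open>P\<close>, so by maximality it can no longer avoid \<open>S\<close>.\<close>
  have meets: "\<exists>p\<in>P. \<exists>r\<in>carrier R. p \<oplus> r \<otimes> x \<in> S" if x: "x \<in> carrier R" "x \<notin> P" for x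
  proof (rule ccontr)
    assume none: "\<not> ?thesis"
    let ?J = "P <+>\<^bsub>R\<^esub> PIdl x"
    have J: "ideal ?J R"
      using add_ideals[OF P(1) cgenideal_ideal[OF x(1)]] .
    have J_mem: "p \<oplus> r \<otimes> x \<in> ?J" if "p \<in> P" "r \<in> carrier R" for p r
      using that by (auto simp: set_add_def' cgenideal_def)
    have "P \<subseteq> ?J"
      using J_mem[of _ \<zero>] x P.a_subset by force
    moreover have "?J \<inter> S = {}"
      using none by (auto simp: set_add_def' cgenideal_def)
    ultimately have "?J = P"
      using P_max J P(2) by simp
    then show False
      using J_mem[of \<zero> \<one>] x by simp
  qed
  have "primeideal P R"
  proof (rule primeidealI[OF P(1) is_cring])
    show "carrier R \<noteq> P" using P(3) S by blast
  next
    fix x y assume xy: "x \<in> carrier R" "y \<in> carrier R" "x \<otimes> y \<in> P"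
    show "x \<in> P \<or> y \<in> P"
    proof (rule ccontr)
      assume "\<not> ?thesis"
      then obtain p r q s where *: "p \<in> P" "r \<in> carrier R" "p \<oplus> r \<otimes> x \<in> S"
        "q \<in> P" "s \<in> carrier R" "q \<oplus> s \<otimes> y \<in> S"
        using meets xy by metis
      have pq: "p \<in> carrier R" "q \<in> carrier R"
        using * P.a_subset by auto
      \<comment> \<open>Every term of the expanded product has a factor \<open>p\<close>,
        \<open>q\<close> or \<open>x \<otimes> y\<close>, so an element of \<open>S\<close> lands in
        \<open>P\<close>.\<close>
      have "(p \<oplus> r \<otimes> x) \<otimes> (q \<oplus> s \<otimes> y) =
          (q \<oplus> s \<otimes> y) \<otimes> p \<oplus> ((r \<otimes> x) \<otimes> q \<oplus> (r \<otimes> s) \<otimes> (x \<otimes> y))"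
        using pq * xy by algebra
      also have "\<dots> \<in> P"
        using * pq xy by (simp add: P.I_l_closed)
      finally show False
        using S(3)[OF *(3,6)] P(3) by blast
    qed
  qed
  then show ?thesis
    using P that by blast
qed

text \<open>The first two members of any chain of positive length already form a strict inclusion.
  Without prime ideals, both sides hold.\<close>

lemma krull_dim_eq_0_iff:
  "krull_dim R = 0 \<longleftrightarrow> (\<forall>P Q. primeideal P R \<longrightarrow> primeideal Q R \<longrightarrow> \<not> P \<subset> Q)"
proof
  assume dim: "krull_dim R = 0"
  show "\<forall>P Q. primeideal P R \<longrightarrow> primeideal Q R \<longrightarrow> \<not> P \<subset> Q"
  proof (intro allI impI notI)
    fix P Q assume "primeideal P R" "primeideal Q R" "P \<subset> Q"
    then have "\<exists>p. (\<forall>i\<le>1. primeideal (p i) R) \<and> (\<forall>i<1. p i \<subset> p (Suc i))"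
      by (intro exI[of _ "\<lambda>i::nat. if i = 0 then P else Q"]) auto
    then have "enat 1 \<le> krull_dim R"
      unfolding krull_dim_def by (intro Sup_upper) blast
    then show False using dim by (simp add: zero_enat_def)
  qed
next
  assume *: "\<forall>P Q. primeideal P R \<longrightarrow> primeideal Q R \<longrightarrow> \<not> P \<subset> Q"
  have "n = 0"
    if p: "\<forall>i\<le>n. primeideal (p i) R" "\<forall>i<n. p i \<subset> p (Suc i)" for n and p :: "nat \<Rightarrow> 'a set"
  proof (rule ccontr)
    assume "n \<noteq> 0"
    then have "primeideal (p 0) R" "primeideal (p 1) R" "p 0 \<subset> p 1"
      using p by auto
    then show False using * by blast
  qed
  then have "krull_dim R \<le> 0"
    unfolding krull_dim_def by (intro Sup_least) (auto simp: zero_enat_def)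
  then show "krull_dim R = 0" by simp
qed

text \<open>Suppose P is strictly below Q and a lies in Q but not in P. Since P contains 0 but no
  power of a, it contains 1 - ar. Then 1 - ar and ar both lie in Q, so Q contains 1.\<close>

lemma krull_dim_eq_0_if_pow_dvd_pow_Suc:
  assumes "\<And>a. a \<in> carrier R \<Longrightarrow> \<exists>m::nat. \<exists>r\<in>carrier R. a [^] m \<otimes> (\<one> \<ominus> a \<otimes> r) = \<zero>"
  shows "krull_dim R = 0"
  unfolding krull_dim_eq_0_iff
proof (intro allI impI notI)
  fix P Q assume PQ: "primeideal P R" "primeideal Q R" "P \<subset> Q"
  interpret P: primeideal P R by fact
  interpret Q: primeideal Q R by fact
  obtain a where a: "a \<in> Q" "a \<notin> P" "a \<in> carrier R"
    using PQ(3) Q.a_subset by blast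
  obtain m :: nat and r where r: "r \<in> carrier R" "a [^] m \<otimes> (\<one> \<ominus> a \<otimes> r) = \<zero>"
    using assms[OF a(3)] by blast
  have "a [^] i \<notin> P" for i :: nat
  proof (induction i)
    case 0
    show ?case using P.I_notcarr P.one_imp_carrier by auto
  next
    case (Suc i)
    then show ?case using P.I_prime[of "a [^] i" a] a by auto
  qed
  then have "\<one> \<ominus> a \<otimes> r \<in> P"
    using P.I_prime[of "a [^] m" "\<one> \<ominus> a \<otimes> r"] r a P.zero_closed by auto
  then have "(\<one> \<ominus> a \<otimes> r) \<oplus> a \<otimes> r \<in> Q"
    using PQ(3) a r by (intro Q.a_closed Q.I_r_closed) auto
  moreover have "(\<one> \<ominus> a \<otimes> r) \<oplus> a \<otimes> r = \<one>"
    using a r by algebra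
  ultimately show False
    using Q.I_notcarr Q.one_imp_carrier by auto
qed

text \<open>
  A prime \<open>P\<close> avoiding the multiplicative set of all \<open>a\<^sup>m (1 - a r)\<close> contains neither \<open>a\<close> nor any
  \<open>1 - a r\<close>, so a prime above \<open>P + aR\<close> is strictly larger than \<open>P\<close>.
\<close>

lemma pow_dvd_pow_Suc_if_krull_dim_eq_0:
  assumes dim: "krull_dim R = 0" and a: "a \<in> carrier R"
  shows "\<exists>m::nat. \<exists>r\<in>carrier R. a [^] m \<otimes> (\<one> \<ominus> a \<otimes> r) = \<zero>"
proof (rule ccontr)
  assume none: "\<not> ?thesis"
  define S where "S = {a [^] m \<otimes> (\<one> \<ominus> a \<otimes> r) | (m::nat) r. r \<in> carrier R}"
  have SI: "a [^] m \<otimes> (\<one> \<ominus> a \<otimes> r) \<in> S" if "r \<in> carrier R" for m :: nat and r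
    using that unfolding S_def by blast
  \<comment> \<open>The witnesses are m = 0 and r = 0.\<close>
  have one: "\<one> \<in> S"
    using SI[of \<zero> 0] a by (simp add: minus_eq)
  have mult: "x \<otimes> y \<in> S" if "x \<in> S" "y \<in> S" for x y
  proof -
    obtain m n :: nat and r s where rs: "r \<in> carrier R" "s \<in> carrier R"
      "x = a [^] m \<otimes> (\<one> \<ominus> a \<otimes> r)" "y = a [^] n \<otimes> (\<one> \<ominus> a \<otimes> s)"
      using \<open>x \<in> S\<close> \<open>y \<in> S\<close> unfolding S_def by blast
    have "x \<otimes> y = (a [^] m \<otimes> a [^] n) \<otimes> ((\<one> \<ominus> a \<otimes> r) \<otimes> (\<one> \<ominus> a \<otimes> s))"
      using rs a nat_pow_closed[OF a, of m] nat_pow_closed[OF a, of n]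
      by (simp add: m_ac)
    also have "a [^] m \<otimes> a [^] n = a [^] (m + n)"
      using a by (simp add: nat_pow_mult)
    \<comment> \<open>With p = ar and q = as, (1 - p)(1 - q) = 1 - (p + q - pq), and p + q - pq is
      again a multiple of a.\<close>
    also have "(\<one> \<ominus> a \<otimes> r) \<otimes> (\<one> \<ominus> a \<otimes> s) = \<one> \<ominus> a \<otimes> (r \<oplus> s \<ominus> a \<otimes> r \<otimes> s)"
    proof -
      have "(\<one> \<ominus> p) \<otimes> (\<one> \<ominus> q) = \<one> \<ominus> (p \<oplus> q \<ominus> p \<otimes> q)"
        if "p \<in> carrier R" "q \<in> carrier R" for p q
        using that by (simp add: minus_eq l_distr r_distr l_minus r_minus minus_add a_ac)
      moreover have "a \<otimes> (r \<oplus> s \<ominus> a \<otimes> r \<otimes> s) = a \<otimes> r \<oplus> a \<otimes> s \<ominus> (a \<otimes> r) \<otimes> (a \<otimes> s)"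
        using rs(1,2) a by (simp add: minus_eq r_distr r_minus m_ac)
      ultimately show ?thesis using rs(1,2) a by simp
    qed
    finally show ?thesis
      using SI rs a by simp
  qed
  obtain P where P: "primeideal P R" "P \<inter> S = {}"
  proof (rule exists_primeideal_disjoint[OF zeroideal _ one mult])
    show "S \<subseteq> carrier R" using a unfolding S_def by auto
    show "{\<zero>} \<inter> S = {}" using none unfolding S_def by (fastforce dest: sym)
  qed
  interpret P: primeideal P R by fact
  have "a \<in> S"
    using SI[of \<zero> 1] a by (simp add: minus_eq)
  then have aP: "a \<notin> P" using P(2) by blast
  let ?J = "P <+>\<^bsub>R\<^esub> PIdl a"
  have J: "ideal ?J R"
    using add_ideals[OF P.is_ideal cgenideal_ideal[OF a]] .
  have J_mem: "p \<oplus> r \<otimes> a \<in> ?J" if "p \<in> P" "r \<in> carrier R" for p r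
    using that by (auto simp: set_add_def' cgenideal_def)
  \<comment> \<open>From 1 = p + ra it would follow that p = 1 - ar, which lies in \<open>S\<close>
    by taking the exponent 0.\<close>
  have "\<one> \<notin> ?J"
  proof
    assume "\<one> \<in> ?J"
    then obtain p r where pr: "p \<in> P" "r \<in> carrier R" "\<one> = p \<oplus> r \<otimes> a"
      by (auto simp: set_add_def' cgenideal_def)
    have "p \<in> carrier R" using pr(1) P.a_subset by blast
    then have "p \<oplus> r \<otimes> a \<ominus> a \<otimes> r = p"
      using pr(2) a by algebra
    then have "\<one> \<ominus> a \<otimes> r = p"
      unfolding pr(3)[symmetric] .
    moreover have "\<one> \<ominus> a \<otimes> r \<in> S"
      using SI[OF pr(2), of 0] pr(2) a by simp
    ultimately show False
      using pr(1) P(2) by blast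
  qed
  \<comment> \<open>For the multiplicative set {1}, avoiding it just means being proper.\<close>
  then obtain Q where Q: "primeideal Q R" "?J \<subseteq> Q"
    using exists_primeideal_disjoint[OF J, of "{\<one>}"] by auto
  have "P \<subseteq> ?J"
    using J_mem[of _ \<zero>] a P.a_subset by force
  moreover have "a \<in> ?J"
    using J_mem[of \<zero> \<one>] a by simp
  ultimately have "P \<subset> Q"
    using aP Q(2) by blast
  then show False
    using dim P(1) Q(1) krull_dim_eq_0_iff by blast
qed

section \<open>Chains of partial products\<close>

lemma r_coset_mono_factor:
  assumes "ideal I R" "u \<in> carrier R" "b \<in> carrier R"
  shows "I #> (u \<otimes> b) \<subseteq> I #> b"
proof -
  interpret I: ideal I R by fact
  have "i \<otimes> (u \<otimes> b) = (i \<otimes> u) \<otimes> b" "i \<otimes> u \<in> I" if "i \<in> I" for i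
    using that assms I.a_subset I.I_r_closed by (auto simp: m_assoc)
  then show ?thesis
    unfolding r_coset_def by fastforce
qed

lemma finprod_atMost_factor:
  fixes a :: "nat \<Rightarrow> 'a"
  assumes a: "\<And>i. a i \<in> carrier R" and "n \<le> k"
  obtains c where "c \<in> carrier R" "finprod R a {..k} = c \<otimes> finprod R a {..n}"
proof -
  have "\<exists>c\<in>carrier R. finprod R a {..k} = c \<otimes> finprod R a {..n}"
    using \<open>n \<le> k\<close>
  proof (induction k rule: dec_induct)
    case base
    show ?case using a by (intro bexI[of _ \<one>]) (auto simp: Pi_def)
  next
    case (step k)
    then obtain c where "c \<in> carrier R" "finprod R a {..k} = c \<otimes> finprod R a {..n}"
      by blast
    then show ?case
      using a by (intro bexI[of _ "a (Suc k) \<otimes> c"]) (auto simp: Pi_def m_assoc)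
  qed
  then show ?thesis using that by blast
qed

text \<open>Taking the ideal to be R turns stabilization into divisibility. Conversely, if b_n = u
  b_k, an arbitrary ideal \<open>I\<close> absorbs \<open>u\<close>, so the same \<open>n\<close>
  serves every \<open>I\<close>.\<close>

lemma strongly_DCCR_star_iff:
  "strongly_DCCR_star R \<longleftrightarrow>
    (\<forall>a :: nat \<Rightarrow> 'a. (\<forall>i. a i \<in> carrier R) \<longrightarrow>
      (\<exists>n. \<forall>k\<ge>n. \<exists>u\<in>carrier R. finprod R a {..n} = u \<otimes> finprod R a {..k}))"
    (is "_ \<longleftrightarrow> ?R")
proof
  assume D: "strongly_DCCR_star R"
  show ?R
  proof (intro allI impI)
    fix a :: "nat \<Rightarrow> 'a" assume a: "\<forall>i. a i \<in> carrier R"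
    then obtain n where
      n: "\<And>k. k \<ge> n \<Longrightarrow> carrier R #> finprod R a {..k} = carrier R #> finprod R a {..n}"
      using D oneideal unfolding strongly_DCCR_star_def by meson
    have "finprod R a {..n} \<in> carrier R #> finprod R a {..n}"
      using a by (auto simp: r_coset_def Pi_def intro!: bexI[of _ \<one>])
    then have "\<exists>u\<in>carrier R. finprod R a {..n} = u \<otimes> finprod R a {..k}" if "k \<ge> n" for k
      using n[OF that] unfolding r_coset_def by blast
    then show "\<exists>n. \<forall>k\<ge>n. \<exists>u\<in>carrier R. finprod R a {..n} = u \<otimes> finprod R a {..k}"
      by blast
  qed
next
  assume D: ?R
  show "strongly_DCCR_star R"
    unfolding strongly_DCCR_star_def
  proof (intro allI impI)
    fix I and a :: "nat \<Rightarrow> 'a" assume I: "ideal I R" and a: "\<forall>i. a i \<in> carrier R"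
    obtain n where n: "\<And>k. k \<ge> n \<Longrightarrow> \<exists>u\<in>carrier R. finprod R a {..n} = u \<otimes> finprod R a {..k}"
      using D a by blast
    have closed: "finprod R a {..k} \<in> carrier R" for k
      using a by (auto simp: Pi_def)
    have "I #> finprod R a {..k} = I #> finprod R a {..n}" if "k \<ge> n" for k
    proof
      show "I #> finprod R a {..k} \<subseteq> I #> finprod R a {..n}"
        using finprod_atMost_factor[of a n k] a that r_coset_mono_factor[OF I] closed by metis
      show "I #> finprod R a {..n} \<subseteq> I #> finprod R a {..k}"
        using n[OF that] r_coset_mono_factor[OF I] closed by metis
    qed
    then show "\<exists>n. \<forall>k\<ge>n. I #> finprod R a {..k} = I #> finprod R a {..n}"
      by blast
  qed
qed

section \<open>Endomorphisms of the ring and chains of principal ideals\<close>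

text \<open>Linearity gives f(x) = f(x 1) = x f(1), so the image is the principal ideal of
  f(1).\<close>

lemma module_End_self_image:
  assumes "f \<in> module_End R (self_module R)"
  shows "f \<one> \<in> carrier R" "f ` carrier R = carrier R #> f \<one>"
proof -
  have closed: "f x \<in> carrier R" if "x \<in> carrier R" for x
    using assms that by (auto simp: module_End_def self_module_def hom_def)
  then show "f \<one> \<in> carrier R" by simp
  have "\<forall>r\<in>carrier R. \<forall>x\<in>carrier R. f (r \<otimes> x) = r \<otimes> f x"
    using assms by (simp add: module_End_def self_module_def)
  then have "f x = x \<otimes> f \<one>" if "x \<in> carrier R" for x
    using that one_closed r_one by metis
  then show "f ` carrier R = carrier R #> f \<one>"
    unfolding r_coset_def UNION_singleton_eq_range by (rule image_cong[OF refl])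
qed

text \<open>An element b corresponds to multiplication by b, and an endomorphism to its value at 1;
  this matches principal ideals with images.\<close>

lemma endoartinian_ring_iff:
  "endoartinian_ring R \<longleftrightarrow>
    (\<forall>b :: nat \<Rightarrow> 'a. (\<forall>i. b i \<in> carrier R) \<longrightarrow>
      (\<forall>i. carrier R #> b (Suc i) \<subseteq> carrier R #> b i) \<longrightarrow>
      (\<exists>n. \<forall>k\<ge>n. carrier R #> b k = carrier R #> b n))"
    (is "_ \<longleftrightarrow> ?R")
proof
  assume E: "endoartinian_ring R"
  show ?R
  proof (intro allI impI)
    fix b :: "nat \<Rightarrow> 'a"
    assume b: "\<forall>i. b i \<in> carrier R" and sub: "\<forall>i. carrier R #> b (Suc i) \<subseteq> carrier R #> b i"
    define f where "f i x = x \<otimes> b i" for i x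
    have "\<forall>i. f i \<in> module_End R (self_module R)"
      using b by (auto simp: module_End_def self_module_def hom_def f_def l_distr m_assoc)
    moreover have im: "f i ` carrier (self_module R) = carrier R #> b i" for i
      by (auto simp: self_module_def f_def r_coset_def)
    ultimately show "\<exists>n. \<forall>k\<ge>n. carrier R #> b k = carrier R #> b n"
      using E sub unfolding endoartinian_ring_def endoartinian_module_def by (metis im)
  qed
next
  assume P: ?R
  have car: "carrier (self_module R) = carrier R"
    by (simp add: self_module_def)
  show "endoartinian_ring R"
    unfolding endoartinian_ring_def endoartinian_module_def car
  proof (intro allI impI)
    fix f :: "nat \<Rightarrow> 'a \<Rightarrow> 'a"
    assume f: "\<forall>i. f i \<in> module_End R (self_module R)"
      and sub: "\<forall>i. f (Suc i) ` carrier R \<subseteq> f i ` carrier R"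
    have "\<forall>i. f i \<one> \<in> carrier R" and im: "\<And>i. f i ` carrier R = carrier R #> f i \<one>"
      using module_End_self_image f by blast+
    then show "\<exists>n. \<forall>k\<ge>n. f k ` carrier R = f n ` carrier R"
      using P[rule_format, of "\<lambda>i. f i \<one>"] sub unfolding im by blast
  qed
qed

lemma endoartinian_iff_strongly_DCCR_star: "endoartinian_ring R \<longleftrightarrow> strongly_DCCR_star R"
proof
  assume E: "endoartinian_ring R"
  show "strongly_DCCR_star R"
    unfolding strongly_DCCR_star_iff
  proof (intro allI impI)
    fix a :: "nat \<Rightarrow> 'a" assume a: "\<forall>i. a i \<in> carrier R"
    let ?b = "\<lambda>k. finprod R a {..k}"
    have closed: "?b k \<in> carrier R" for k
      using a by (auto simp: Pi_def)
    have "?b (Suc k) = a (Suc k) \<otimes> ?b k" for k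
      using a by (simp add: Pi_def)
    then have "carrier R #> ?b (Suc k) \<subseteq> carrier R #> ?b k" for k
      using r_coset_mono_factor[OF oneideal, of "a (Suc k)" "?b k"] a closed by metis
    then obtain n where n: "\<And>k. k \<ge> n \<Longrightarrow> carrier R #> ?b k = carrier R #> ?b n"
      using E[unfolded endoartinian_ring_iff, rule_format, of ?b] closed by blast
    have "?b n \<in> carrier R #> ?b n"
      using closed by (auto simp: r_coset_def intro!: bexI[of _ \<one>])
    then have "\<exists>u\<in>carrier R. ?b n = u \<otimes> ?b k" if "k \<ge> n" for k
      using n[OF that] unfolding r_coset_def by blast
    then show "\<exists>n. \<forall>k\<ge>n. \<exists>u\<in>carrier R. ?b n = u \<otimes> ?b k"
      by blast
  qed
next
  assume D: "strongly_DCCR_star R"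
  show "endoartinian_ring R"
    unfolding endoartinian_ring_iff
  proof (intro allI impI)
    fix b :: "nat \<Rightarrow> 'a"
    assume b: "\<forall>i. b i \<in> carrier R" and sub: "\<forall>i. carrier R #> b (Suc i) \<subseteq> carrier R #> b i"
    have "\<exists>c\<in>carrier R. b (Suc i) = c \<otimes> b i" for i
    proof -
      have "b (Suc i) \<in> carrier R #> b (Suc i)"
        using b by (auto simp: r_coset_def intro!: bexI[of _ \<one>])
      then show ?thesis
        using sub unfolding r_coset_def by blast
    qed
    then obtain c where c: "\<And>i. c i \<in> carrier R" "\<And>i. b (Suc i) = c i \<otimes> b i"
      by metis
    \<comment> \<open>Prepending \<open>b 0\<close> to the successive quotients makes the product of
      \<open>a\<close> over \<open>{..k}\<close> telescope to exactly \<open>b k\<close>.\<close>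
    define a where "a = case_nat (b 0) c"
    have a: "a i \<in> carrier R" for i
      using b c by (simp add: a_def split: nat.split)
    have prod: "finprod R a {..k} = b k" for k
    proof (induction k)
      case 0
      show ?case using a b by (simp add: Pi_def a_def)
    next
      case (Suc k)
      then show ?case using a c by (simp add: Pi_def) (simp add: a_def)
    qed
    obtain n where "\<And>k. k \<ge> n \<Longrightarrow> carrier R #> finprod R a {..k} = carrier R #> finprod R a {..n}"
      using D oneideal a unfolding strongly_DCCR_star_def by meson
    then show "\<exists>n. \<forall>k\<ge>n. carrier R #> b k = carrier R #> b n"
      unfolding prod by blast
  qed
qed

section \<open>Colon ideals and the ascending condition\<close>

lemma ideal_colon_mono_factor:
  assumes "ideal I R" "u \<in> carrier R" "b \<in> carrier R"
  shows "ideal_colon R I b \<subseteq> ideal_colon R I (u \<otimes> b)"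
proof -
  interpret I: ideal I R by fact
  show ?thesis
    using assms I.I_l_closed by (auto simp: ideal_colon_def m_assoc)
qed

text \<open>From some index on, the partial products divide each other, and multiplying an element
  by a factor can only enlarge its colon ideal.\<close>

lemma strongly_DCCR_star_imp_ACCR_star:
  assumes "strongly_DCCR_star R"
  shows "strongly_ACCR_star R"
  unfolding strongly_ACCR_star_def
proof (intro allI impI)
  fix I and a :: "nat \<Rightarrow> 'a" assume I: "ideal I R" and a: "\<forall>i. a i \<in> carrier R"
  let ?b = "\<lambda>k. finprod R a {..k}"
  have closed: "?b k \<in> carrier R" for k
    using a by (auto simp: Pi_def)
  obtain n where n: "\<And>k. k \<ge> n \<Longrightarrow> \<exists>u\<in>carrier R. ?b n = u \<otimes> ?b k"
    using assms a unfolding strongly_DCCR_star_iff by blast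
  have "ideal_colon R I (?b k) = ideal_colon R I (?b n)" if "k \<ge> n" for k
  proof
    show "ideal_colon R I (?b k) \<subseteq> ideal_colon R I (?b n)"
      using n[OF that] ideal_colon_mono_factor[OF I] closed by metis
    show "ideal_colon R I (?b n) \<subseteq> ideal_colon R I (?b k)"
      using finprod_atMost_factor[of a n k] a that ideal_colon_mono_factor[OF I] closed by metis
  qed
  then show "\<exists>n. \<forall>k\<ge>n. ideal_colon R I (?b k) = ideal_colon R I (?b n)"
    by blast
qed

lemma strongly_DCCR_star_imp_krull_dim_eq_0:
  assumes "strongly_DCCR_star R"
  shows "krull_dim R = 0"
proof (rule krull_dim_eq_0_if_pow_dvd_pow_Suc)
  fix a assume a: "a \<in> carrier R"
  \<comment> \<open>The index set \<open>{..k}\<close> has k + 1 elements, hence the exponent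
    \<open>Suc k\<close>.\<close>
  have pow: "finprod R (\<lambda>_. a) {..k} = a [^] Suc k" for k
    using a finprod_const[of a "{..k}"] by simp
  have "\<exists>n. \<forall>k\<ge>n. \<exists>u\<in>carrier R. a [^] Suc n = u \<otimes> a [^] Suc k"
    using assms[unfolded strongly_DCCR_star_iff, THEN spec, of "\<lambda>_. a"] a unfolding pow by blast
  then obtain n u where u: "u \<in> carrier R" "a [^] Suc n = u \<otimes> a [^] Suc (Suc n)"
    using le_SucI[OF order_refl] by meson
  define p where "p = a [^] Suc n"
  have p: "p \<in> carrier R" "p = u \<otimes> (p \<otimes> a)"
    using u a by (simp_all add: p_def)
  have "p \<otimes> (\<one> \<ominus> a \<otimes> u) = p \<ominus> u \<otimes> (p \<otimes> a)"
    using p(1) u(1) a by (simp add: minus_eq r_distr r_minus m_ac)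
  also have "\<dots> = \<zero>"
    using p by (simp add: minus_eq r_neg)
  finally show "\<exists>m::nat. \<exists>r\<in>carrier R. a [^] m \<otimes> (\<one> \<ominus> a \<otimes> r) = \<zero>"
    using u(1) unfolding p_def by blast
qed

lemma strongly_ACCR_star_imp_DCCR_star:
  assumes A: "strongly_ACCR_star R" and dim: "krull_dim R = 0"
  shows "strongly_DCCR_star R"
  unfolding strongly_DCCR_star_iff
proof (intro allI impI)
  fix a :: "nat \<Rightarrow> 'a" assume a: "\<forall>i. a i \<in> carrier R"
  let ?b = "\<lambda>k. finprod R a {..k}"
  have closed: "?b k \<in> carrier R" for k
    using a by (auto simp: Pi_def)
  have Suc_b: "?b (Suc k) = a (Suc k) \<otimes> ?b k" for k
    using a by (simp add: Pi_def)
  \<comment> \<open>For the zero ideal, the colon ideals are the annihilators of the partial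
    products.\<close>
  obtain n where n: "\<And>k. k \<ge> n \<Longrightarrow> ideal_colon R {\<zero>} (?b k) = ideal_colon R {\<zero>} (?b n)"
    using A zeroideal a unfolding strongly_ACCR_star_def by meson
  \<comment> \<open>The hypothesis says that \<open>x\<close> annihilates \<open>?b (Suc k)\<close>,
    whose annihilator equals that of \<open>?b k\<close>.\<close>
  have cancel: "?b k \<otimes> x = \<zero>"
    if "k \<ge> n" "x \<in> carrier R" "?b k \<otimes> (a (Suc k) \<otimes> x) = \<zero>" for k x
  proof -
    have "?b (Suc k) \<otimes> x = \<zero>"
      using that a closed[of k] by (simp add: Suc_b m_ac)
    then have "x \<in> ideal_colon R {\<zero>} (?b k)"
      using n[of k] n[of "Suc k"] that by (auto simp: ideal_colon_def)
    then show ?thesis by (simp add: ideal_colon_def)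
  qed
  have dvd_Suc: "\<exists>r\<in>carrier R. ?b k = r \<otimes> ?b (Suc k)" if k: "k \<ge> n" for k
  proof -
    let ?a = "a (Suc k)"
    have a': "?a \<in> carrier R" using a by blast
    obtain m :: nat and r where r: "r \<in> carrier R" "?a [^] m \<otimes> (\<one> \<ominus> ?a \<otimes> r) = \<zero>"
      using pow_dvd_pow_Suc_if_krull_dim_eq_0[OF dim a'] by blast
    let ?x = "\<one> \<ominus> ?a \<otimes> r"
    have x: "?x \<in> carrier R" using a' r by simp
    \<comment> \<open>The factors of the power are cancelled one at a time, always with the same
      index \<open>k\<close>.\<close>
    have cancel_pow: "?b k \<otimes> (?a [^] i \<otimes> ?x) = \<zero> \<Longrightarrow> ?b k \<otimes> ?x = \<zero>" for i :: nat
    proof (induction i)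
      case 0
      then show ?case using x by simp
    next
      case (Suc i)
      have "?a [^] Suc i \<otimes> ?x = ?a \<otimes> (?a [^] i \<otimes> ?x)"
        using a' x by (simp add: m_ac)
      then have "?b k \<otimes> (?a [^] i \<otimes> ?x) = \<zero>"
        using Suc.prems cancel[OF k, of "?a [^] i \<otimes> ?x"] a' x by simp
      then show ?case using Suc.IH by blast
    qed
    have zero: "?b k \<otimes> ?x = \<zero>"
      by (rule cancel_pow[of m]) (simp only: r(2) r_null closed)
    \<comment> \<open>This splits 1 as (1 - ar) + ar; the first summand kills \<open>?b k\<close>,
      and the second produces \<open>?b (Suc k)\<close>.\<close>
    have "?b k = ?b k \<otimes> ?x \<oplus> r \<otimes> (?a \<otimes> ?b k)"
      using closed[of k] a' r(1) by algebra
    then have "?b k = r \<otimes> ?b (Suc k)"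
      unfolding zero using closed[of k] a' r(1) by (simp add: Suc_b)
    then show ?thesis using r(1) by blast
  qed
  \<comment> \<open>The one-step quotients are multiplied together along the way from
    \<open>n\<close> to \<open>k\<close>.\<close>
  have "\<exists>u\<in>carrier R. ?b n = u \<otimes> ?b k" if "n \<le> k" for k
    using that
  proof (induction k rule: dec_induct)
    case base
    show ?case using closed by (intro bexI[of _ \<one>]) auto
  next
    case (step k)
    obtain u where u: "u \<in> carrier R" "?b n = u \<otimes> ?b k"
      using step.IH by blast
    obtain r where r: "r \<in> carrier R" "?b k = r \<otimes> ?b (Suc k)"
      using dvd_Suc step.hyps by blast
    have "?b n = (u \<otimes> r) \<otimes> ?b (Suc k)"
      unfolding u(2) using r(2) m_assoc[OF u(1) r(1) closed] by metis
    then show ?case using u(1) r(1) by blast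
  qed
  then show "\<exists>n. \<forall>k\<ge>n. \<exists>u\<in>carrier R. ?b n = u \<otimes> ?b k"
    by blast
qed

end

theorem theorem2p11:
  fixes R :: "('a, 'k) ring_scheme"
  assumes "cring R"
  shows "(endoartinian_ring R \<longleftrightarrow> strongly_DCCR_star R) \<and>
    (strongly_DCCR_star R \<longleftrightarrow> strongly_ACCR_star R \<and> krull_dim R = 0)"
proof -
  interpret cring R by fact
  show ?thesis
    using endoartinian_iff_strongly_DCCR_star strongly_DCCR_star_imp_ACCR_star
      strongly_DCCR_star_imp_krull_dim_eq_0 strongly_ACCR_star_imp_DCCR_star by blast
qed

end
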